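(* For every integer $k \ge 3$, there exists a non-planar connected graph $G$ satisfying $\mathrm{cdim}(G)=k$.
   Context: All graphs are finite, simple, undirected. A graph is planar if it can be drawn in the plane without edge crossings. A set $S\subseteq V(G)$ is a resolving set of $G$ if for every pair of distinct vertices $x,y$ of $G$ there is $z\in S$ with $d(x,z)\ne d(y,z)$ ($d$ is the shortest-path distance); it is a connected resolving set if moreover the induced subgraph $G[S]$ is connected. $\mathrm{cdim}(G)$ is the minimum cardinality of a connected resolving set of $G$. *)

theory Defs
  imports "HOL-Analysis.Analysis" "Graph_Theory.Graph_Theory"
begin

text \<open>
  A finite simple undirected graph is a \<^locale>\<open>pair_graph\<close>: a finite loop-free symmetric digraph
  without parallel arcs, the undirected edge \<open>uv\<close> being the pair of arcs \<open>(u,v)\<close>, \<open>(v,u)\<close>.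
\<close>

text \<open>
  A crossing-free drawing in the plane, which is taken to be the complex plane. The curves are
  indexed by unordered pairs, so that each undirected edge is drawn once. A curve meets the
  vertex points in its own ends only, and two curves meet in common end vertices only.
\<close>

definition plane_drawing ::
  "'a pair_pre_digraph \<Rightarrow> ('a \<Rightarrow> complex) \<Rightarrow> ('a set \<Rightarrow> real \<Rightarrow> complex) \<Rightarrow> bool" where
  "plane_drawing G p c \<longleftrightarrow>
     inj_on p (pverts G) \<and>
     (\<forall>(u, v) \<in> parcs G.
        arc (c {u, v}) \<and>
        {pathstart (c {u, v}), pathfinish (c {u, v})} = {p u, p v} \<and>
        path_image (c {u, v}) \<inter> p ` pverts G = {p u, p v}) \<and>
     (\<forall>(u, v) \<in> parcs G. \<forall>(x, y) \<in> parcs G. {u, v} \<noteq> {x, y} \<longrightarrow>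
        path_image (c {u, v}) \<inter> path_image (c {x, y}) \<subseteq> p ` ({u, v} \<inter> {x, y}))"

definition planar :: "'a pair_pre_digraph \<Rightarrow> bool" where
  "planar G \<longleftrightarrow> (\<exists>p c. plane_drawing G p c)"

text \<open>The value is \<open>\<infinity>\<close> if there is no path from \<open>u\<close> to \<open>v\<close>.\<close>

definition gdist :: "'a pair_pre_digraph \<Rightarrow> 'a \<Rightarrow> 'a \<Rightarrow> ereal" where
  "gdist G u v = wf_digraph.\<mu> (with_proj G) (\<lambda>_. 1) u v"

definition resolving_set :: "'a pair_pre_digraph \<Rightarrow> 'a set \<Rightarrow> bool" where
  "resolving_set G S \<longleftrightarrow> S \<subseteq> pverts G \<and>
     (\<forall>x \<in> pverts G. \<forall>y \<in> pverts G. x \<noteq> y \<longrightarrow> (\<exists>z \<in> S. gdist G x z \<noteq> gdist G y z))"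

text \<open>The name \<open>connected\<close> alone could also denote topological connectedness.\<close>

definition connected_resolving_set :: "'a pair_pre_digraph \<Rightarrow> 'a set \<Rightarrow> bool" where
  "connected_resolving_set G S \<longleftrightarrow>
     resolving_set G S \<and> Digraph_Component.connected (with_proj G \<restriction> S)"

text \<open>
  The minimum exists for every connected \<open>G\<close>, as then \<^term>\<open>pverts G\<close> is a connected resolving set;
  for other graphs the value can be unspecified.
\<close>

definition cdim :: "'a pair_pre_digraph \<Rightarrow> nat" where
  "cdim G = (LEAST n. \<exists>S. connected_resolving_set G S \<and> card S = n)"

end

theory Submission
  imports Defs "HOL-Complex_Analysis.Winding_Numbers"
begin

text \<open>
  The witness is the complement \<open>G\<close> of the disjoint union of a star with \<open>k - 1\<close> leaves and a star
  with two leaves. Any two of its vertices have distance at most two, so a vertex tells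
  apart two other vertices exactly if it is adjacent to one of them only. Leaves of the same star
  are twins, whence a resolving set contains all leaves but at most one of each star. These
  \<open>k - 1\<close> vertices do not suffice, because the two omitted leaves are adjacent to
  all of them (\<open>card_resolving_set_two_star_complement\<close>). Adding the centre of the large star repairs
  this, and the result is connected (\<open>connected_resolving_set_two_star_complement\<close>). So the minimum
  is \<open>k\<close>.

  The centre and two leaves of the large star together with all three vertices of the small star
  span a $K_{3,3}$, so \<open>G\<close> is not planar (\<open>K33_not_planar\<close>). In a drawing of a $K_{3,3}$, two
  vertices of one side and the three vertices of the other give a theta curve,
  three arcs with common ends, and the remaining vertex with its edges lies in one face of
  the theta curve and reaches all three arcs. This is impossible (\<open>theta_no_common_face\<close>). The
  reason is a parity: the winding numbers of the three loops in a theta curve, suitably oriented,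
  add up to zero, while each is \<open>\<plusminus>1\<close> inside its loop and \<open>0\<close> outside, so no point is inside exactly
  one loop. On the other hand, the Jordan curve theorem shows that exactly one of the open
  arcs runs inside the loop of the other two, and a face that borders on all three arcs would be
  on the same sides of the loops as these arcs, hence inside exactly one loop.
\<close>

section \<open>Theta curves\<close>

definition parallel_arcs :: "complex \<Rightarrow> complex \<Rightarrow> (real \<Rightarrow> complex) \<Rightarrow> (real \<Rightarrow> complex) \<Rightarrow> bool" where
  "parallel_arcs a b f g \<longleftrightarrow>
     arc f \<and> arc g \<and> pathstart f = a \<and> pathfinish f = b \<and> pathstart g = a \<and> pathfinish g = b \<and>
     path_image f \<inter> path_image g = {a, b}"

definition theta_curve :: "complex \<Rightarrow> complex \<Rightarrow> (real \<Rightarrow> complex) \<Rightarrow> (real \<Rightarrow> complex) \<Rightarrow> (real \<Rightarrow> complex) \<Rightarrow> bool" where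
  "theta_curve a b f g h \<longleftrightarrow> parallel_arcs a b f g \<and> parallel_arcs a b f h \<and> parallel_arcs a b g h"

lemma parallel_arcs_commute: "parallel_arcs a b f g \<Longrightarrow> parallel_arcs a b g f"
  unfolding parallel_arcs_def by auto

lemma theta_swap: "theta_curve a b f g h \<Longrightarrow> theta_curve a b g f h"
  and theta_swap': "theta_curve a b f g h \<Longrightarrow> theta_curve a b f h g"
  unfolding theta_curve_def by (blast intro: parallel_arcs_commute)+

lemma parallel_arcs_loop:
  assumes "parallel_arcs a b f g"
  shows "simple_path (f +++ reversepath g)"
    and "pathfinish (f +++ reversepath g) = pathstart (f +++ reversepath g)"
    and "path_image (f +++ reversepath g) = path_image f \<union> path_image g"
  using assms unfolding parallel_arcs_def
  by (auto intro!: simple_path_join_loop arc_reversepath simp: path_image_join)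

text \<open>
  The difference of the two winding numbers is the winding number of the loop along \<open>f\<close> and back
  along \<open>g\<close>. For a simple loop it is \<open>\<plusminus>1\<close> inside and \<open>0\<close> outside.
\<close>

lemma winding_number_eq_iff_not_inside:
  assumes "parallel_arcs a b f g" and p: "p \<notin> path_image f" "p \<notin> path_image g"
  shows "winding_number f p = winding_number g p \<longleftrightarrow> p \<notin> inside (path_image f \<union> path_image g)"
proof -
  note loop = parallel_arcs_loop[OF assms(1)]
  have "winding_number (f +++ reversepath g) p = winding_number f p - winding_number g p"
    using assms unfolding parallel_arcs_def
    by (simp add: winding_number_join winding_number_reversepath arc_imp_path)
  moreover have "winding_number (f +++ reversepath g) p \<noteq> 0"
    if "p \<in> inside (path_image f \<union> path_image g)"
    using simple_closed_path_norm_winding_number_inside[OF loop(1), of p] that loop(3) by auto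
  moreover have "winding_number (f +++ reversepath g) p = 0"
    if "p \<notin> inside (path_image f \<union> path_image g)"
  proof (rule winding_number_zero_in_outside)
    show "p \<in> outside (path_image (f +++ reversepath g))"
      unfolding loop(3)
      using that p inside_Un_outside[of "path_image f \<union> path_image g"] by blast
  qed (use loop simple_path_imp_path in auto)
  ultimately show ?thesis by auto
qed

text \<open>
  By the previous lemma, lying outside a loop is the equality of two of the three numbers that
  \<open>f\<close>, \<open>g\<close> and \<open>h\<close> have at \<open>p\<close>, and two equalities imply the third.
\<close>

lemma theta_not_inside_exactly_one:
  assumes "theta_curve a b f g h" and "p \<notin> path_image f" "p \<notin> path_image g" "p \<notin> path_image h"
    and "p \<in> inside (path_image f \<union> path_image g)"
  shows "p \<in> inside (path_image f \<union> path_image h) \<or> p \<in> inside (path_image g \<union> path_image h)"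
  using assms winding_number_eq_iff_not_inside[of a b _ _ p] unfolding theta_curve_def by metis

lemma connected_inside_or_outside:
  fixes S W :: "complex set"
  assumes "closed S" "topological_space_class.connected W" "W \<inter> S = {}"
  shows "W \<subseteq> inside S \<or> W \<subseteq> outside S"
proof -
  have "open (inside S)" "open (outside S)" using assms by (auto simp: open_inside open_outside)
  moreover have "W \<subseteq> inside S \<union> outside S" using assms by (auto simp: inside_Un_outside)
  moreover have "inside S \<inter> outside S = {}" by (rule inside_Int_outside)
  ultimately show ?thesis using assms(2) connectedD[of W "inside S" "outside S"] by blast
qed

lemma parallel_arcs_Jordan:
  assumes "parallel_arcs a b f g"
  defines "C \<equiv> path_image f \<union> path_image g"
  shows "closed C" "open (inside C)" "open (outside C)" "topological_space_class.connected (inside C)" "topological_space_class.connected (outside C)"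
    "inside C \<noteq> {}" "bounded (inside C)" "\<not> bounded (outside C)"
    "closure (inside C) = inside C \<union> C" "closure (outside C) = outside C \<union> C"
proof -
  note J = Jordan_inside_outside[OF parallel_arcs_loop(1,2)[OF assms(1)],
      unfolded parallel_arcs_loop(3)[OF assms(1)], folded C_def]
  show "open (inside C)" "open (outside C)" "topological_space_class.connected (inside C)" "topological_space_class.connected (outside C)"
    "inside C \<noteq> {}" "bounded (inside C)" "\<not> bounded (outside C)"
    "closure (inside C) = inside C \<union> C" "closure (outside C) = outside C \<union> C"
    using J closure_Un_frontier[of "inside C"] closure_Un_frontier[of "outside C"] by auto
  show "closed C" 
    using J by (metis frontier_closed)
qed

lemma theta_third_arc_side:
  assumes "theta_curve a b f g h"
  shows "path_image h - {a, b} \<subseteq> inside (path_image f \<union> path_image g) \<or>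
         path_image h - {a, b} \<subseteq> outside (path_image f \<union> path_image g)"
proof (rule connected_inside_or_outside)
  show "closed (path_image f \<union> path_image g)"
    using assms parallel_arcs_Jordan(1) unfolding theta_curve_def by blast
  show "topological_space_class.connected (path_image h - {a, b})"
    using assms connected_simple_path_endless[of h] arc_imp_simple_path
    unfolding theta_curve_def parallel_arcs_def by auto
  show "(path_image h - {a, b}) \<inter> (path_image f \<union> path_image g) = {}"
    using assms unfolding theta_curve_def parallel_arcs_def by auto
qed

text \<open>
  The inside of the loop \<open>fg\<close> is connected and meets neither \<open>f\<close> nor, as \<open>h\<close> runs outside, \<open>h\<close>.
  So it stays on one side of the loop \<open>fh\<close>, and \<open>g\<close>, which lies in its closure, is
  carried along to that side.
\<close>

lemma theta_nested:
  assumes th: "theta_curve a b f g h"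
    and out: "path_image h - {a, b} \<subseteq> outside (path_image f \<union> path_image g)"
    and meet: "inside (path_image f \<union> path_image g) \<inter> inside (path_image f \<union> path_image h) \<noteq> {}"
  shows "path_image g - {a, b} \<subseteq> inside (path_image f \<union> path_image h)"
proof -
  let ?I = "inside (path_image f \<union> path_image g)" and ?C = "path_image f \<union> path_image h"
  note Jfg = parallel_arcs_Jordan[of a b f g] and Jfh = parallel_arcs_Jordan[of a b f h]
  have par: "parallel_arcs a b f g" "parallel_arcs a b f h" "parallel_arcs a b g h"
    using th unfolding theta_curve_def by auto
  have ab: "a \<in> path_image f" "b \<in> path_image f"
    using par(1) unfolding parallel_arcs_def by auto
  have "?I \<inter> path_image h = {}"
    using out ab inside_Int_outside[of "path_image f \<union> path_image g"]
      inside_no_overlap[of "path_image f \<union> path_image g"] by blast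
  then have "?I \<inter> ?C = {}"
    using inside_no_overlap[of "path_image f \<union> path_image g"] by blast
  then have "?I \<subseteq> inside ?C"
    using connected_inside_or_outside[OF Jfh(1)[OF par(2)] Jfg(4)[OF par(1)]] meet
      inside_Int_outside[of ?C] by blast
  then have "closure ?I \<subseteq> closure (inside ?C)"
    by (rule closure_mono)
  then have "path_image g \<subseteq> inside ?C \<union> ?C"
    using Jfg(9)[OF par(1)] Jfh(9)[OF par(2)] by auto
  then show ?thesis
    using par unfolding parallel_arcs_def by blast
qed

text \<open>
  If \<open>h\<close> runs outside the loop \<open>fg\<close>, then a point inside \<open>fg\<close> is inside a second loop as
  well, by the parity of the winding numbers. This makes the insides of the two loops meet, so
  that \<open>theta_nested\<close> applies.
\<close>

lemma theta_some_arc_inside: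
  assumes th: "theta_curve a b f g h"
  shows "path_image h - {a, b} \<subseteq> inside (path_image f \<union> path_image g) \<or>
         path_image g - {a, b} \<subseteq> inside (path_image f \<union> path_image h) \<or>
         path_image f - {a, b} \<subseteq> inside (path_image g \<union> path_image h)"
proof (cases "path_image h - {a, b} \<subseteq> inside (path_image f \<union> path_image g)")
  case False
  then have out: "path_image h - {a, b} \<subseteq> outside (path_image f \<union> path_image g)"
    using theta_third_arc_side[OF th] by blast
  have par: "parallel_arcs a b f g" "parallel_arcs a b f h" "parallel_arcs a b g h"
    using th unfolding theta_curve_def by auto
  obtain p where p: "p \<in> inside (path_image f \<union> path_image g)"
    using parallel_arcs_Jordan(6)[OF par(1)] by blast
  have pfg: "p \<notin> path_image f" "p \<notin> path_image g"
    using p inside_no_overlap[of "path_image f \<union> path_image g"] by blast+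
  moreover have "p \<notin> path_image h"
    using p pfg out inside_Int_outside[of "path_image f \<union> path_image g"] par(1)
    unfolding parallel_arcs_def by blast
  ultimately have "p \<in> inside (path_image f \<union> path_image h) \<or> p \<in> inside (path_image g \<union> path_image h)"
    using theta_not_inside_exactly_one[OF th] p by blast
  then show ?thesis
    using theta_nested[OF th out] theta_nested[OF theta_swap[OF th]] out p
    by (auto simp: Un_commute)
qed blast

text \<open>
  The same transport argument as in \<open>theta_nested\<close>, for the outside of the loop \<open>fg\<close>. Here the
  side is determined because an unbounded set does not fit inside a loop.
\<close>

lemma theta_other_arc_outside:
  assumes th: "theta_curve a b f g h"
    and ins: "path_image h - {a, b} \<subseteq> inside (path_image f \<union> path_image g)"
  shows "path_image g - {a, b} \<subseteq> outside (path_image f \<union> path_image h)"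
proof -
  let ?O = "outside (path_image f \<union> path_image g)" and ?C = "path_image f \<union> path_image h"
  note Jfg = parallel_arcs_Jordan[of a b f g] and Jfh = parallel_arcs_Jordan[of a b f h]
  have par: "parallel_arcs a b f g" "parallel_arcs a b f h" "parallel_arcs a b g h"
    using th unfolding theta_curve_def by auto
  have ab: "a \<in> path_image f" "b \<in> path_image f"
    using par(1) unfolding parallel_arcs_def by auto
  have "?O \<inter> ?C = {}"
    using ins ab inside_Int_outside[of "path_image f \<union> path_image g"]
      outside_no_overlap[of "path_image f \<union> path_image g"] by blast
  then have "?O \<subseteq> outside ?C"
    using connected_inside_or_outside[OF Jfh(1)[OF par(2)] Jfg(5)[OF par(1)]]
      Jfg(8)[OF par(1)] Jfh(7)[OF par(2)] bounded_subset by blast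
  then have "closure ?O \<subseteq> closure (outside ?C)"
    by (rule closure_mono)
  then have "path_image g \<subseteq> outside ?C \<union> ?C"
    using Jfg(10)[OF par(1)] Jfh(10)[OF par(2)] by auto
  then show ?thesis
    using par unfolding parallel_arcs_def by blast
qed

lemma connected_subset_of_open_side:
  fixes W S :: "complex set"
  assumes "closed S" "topological_space_class.connected W" "W \<inter> S = {}" "closure W \<inter> X \<noteq> {}"
  shows "X \<subseteq> inside S \<Longrightarrow> W \<subseteq> inside S" and "X \<subseteq> outside S \<Longrightarrow> W \<subseteq> outside S"
proof -
  have *: "W \<inter> T \<noteq> {}" if "open T" "X \<subseteq> T" for T
    using that assms(4) open_Int_closure_eq_empty[of T W] by blast
  show "X \<subseteq> inside S \<Longrightarrow> W \<subseteq> inside S" "X \<subseteq> outside S \<Longrightarrow> W \<subseteq> outside S"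
    using *[of "inside S"] *[of "outside S"] connected_inside_or_outside[OF assms(1-3)]
      inside_Int_outside[of S] open_inside[OF assms(1)] open_outside[OF assms(1)] by blast+
qed

text \<open>
  A connected set that accumulates at an open arc lies on the same side of the opposite loop as this
  arc. So \<open>W\<close> would be inside the loop \<open>fg\<close> and outside the two others, which the parity of
  the winding numbers excludes.
\<close>

lemma theta_inner_arc_no_common_face:
  assumes th: "theta_curve a b f g h"
    and W: "topological_space_class.connected W" "W \<inter> (path_image f \<union> path_image g \<union> path_image h) = {}"
    and cl: "closure W \<inter> (path_image f - {a, b}) \<noteq> {}" "closure W \<inter> (path_image g - {a, b}) \<noteq> {}"
      "closure W \<inter> (path_image h - {a, b}) \<noteq> {}"
    and ins: "path_image h - {a, b} \<subseteq> inside (path_image f \<union> path_image g)"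
  shows False
proof -
  have par: "parallel_arcs a b f g" "parallel_arcs a b f h" "parallel_arcs a b g h"
    using th unfolding theta_curve_def by auto
  note closed = par[THEN parallel_arcs_Jordan(1)]
  have "W \<subseteq> inside (path_image f \<union> path_image g)"
    using connected_subset_of_open_side(1)[OF closed(1) W(1) _ cl(3) ins] W(2) by blast
  moreover have "W \<subseteq> outside (path_image f \<union> path_image h)"
    using connected_subset_of_open_side(2)[OF closed(2) W(1) _ cl(2)
        theta_other_arc_outside[OF th ins]] W(2) by blast
  moreover have "W \<subseteq> outside (path_image g \<union> path_image h)"
    using connected_subset_of_open_side(2)[OF closed(3) W(1) _ cl(1)
        theta_other_arc_outside[OF theta_swap[OF th]]] W(2) ins by (simp add: Un_commute) blast
  moreover obtain p where "p \<in> W" using cl(1) by fastforce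
  ultimately show False
    using theta_not_inside_exactly_one[OF th, of p] W(2)
      inside_Int_outside[of "path_image f \<union> path_image h"]
      inside_Int_outside[of "path_image g \<union> path_image h"] by blast
qed

text \<open>
  No face of a theta curve has points of all three open arcs on its boundary. The set \<open>W\<close>
  stands for a part of the face.
\<close>

lemma theta_no_common_face:
  assumes th: "theta_curve a b f g h"
    and W: "topological_space_class.connected W" "W \<inter> (path_image f \<union> path_image g \<union> path_image h) = {}"
    and cl: "closure W \<inter> (path_image f - {a, b}) \<noteq> {}" "closure W \<inter> (path_image g - {a, b}) \<noteq> {}"
      "closure W \<inter> (path_image h - {a, b}) \<noteq> {}"
  shows False
  using theta_some_arc_inside[OF th]
proof (elim disjE)
  assume "path_image h - {a, b} \<subseteq> inside (path_image f \<union> path_image g)"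
  then show False using theta_inner_arc_no_common_face[OF th W cl] by blast
next
  assume "path_image g - {a, b} \<subseteq> inside (path_image f \<union> path_image h)"
  then show False
    using theta_inner_arc_no_common_face[OF theta_swap'[OF th] W(1) _ cl(1,3,2)] W(2) by blast
next
  assume "path_image f - {a, b} \<subseteq> inside (path_image g \<union> path_image h)"
  then show False
    using theta_inner_arc_no_common_face[OF theta_swap'[OF theta_swap[OF th]] W(1) _ cl(2,3,1)] W(2)
    by blast
qed

section \<open>Non-planarity of graphs that contain a $K_{3,3}$\<close>

lemma arc_minus_finish:
  fixes g :: "real \<Rightarrow> 'a::metric_space"
  assumes "arc g"
  shows "topological_space_class.connected (path_image g - {pathfinish g})"
    and "pathfinish g \<in> closure (path_image g - {pathfinish g})"
    and "pathstart g \<in> path_image g - {pathfinish g}"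
proof -
  have eq: "path_image g - {pathfinish g} = g ` {0..<1}"
  proof -
    have "inj_on g {0..1}" and "{0..1} - {1::real} = {0..<1}"
      using assms unfolding arc_def by auto
    then show ?thesis
      unfolding path_image_def pathfinish_def
      using inj_on_image_set_diff[of g "{0..1}" "{0..1}" "{1}"] by auto
  qed
  have "continuous_on {0..<1} g"
    using arc_imp_path[OF assms] unfolding path_def by (rule continuous_on_subset) auto
  then show "topological_space_class.connected (path_image g - {pathfinish g})"
    unfolding eq by (intro connected_continuous_image) auto
  show s: "pathstart g \<in> path_image g - {pathfinish g}"
    using arc_distinct_ends[OF assms] by auto
  have "pathfinish g islimpt path_image g"
  proof (rule connected_imp_perfect)
    show "path_image g \<noteq> {x}" for x
      using s pathfinish_in_path_image[of g] by (metis DiffE singletonD singletonI)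
  qed (use assms in \<open>auto intro: connected_path_image arc_imp_path\<close>)
  then show "pathfinish g \<in> closure (path_image g - {pathfinish g})"
    by (simp add: islimpt_in_closure)
qed

text \<open>
  The paths from \<open>x1\<close> to \<open>x2\<close> through \<open>y1\<close>, \<open>y2\<close> and \<open>y3\<close> form a theta curve, and the three
  edges at \<open>x3\<close>, stripped of their ends \<open>y1\<close>, \<open>y2\<close> and \<open>y3\<close>, form a connected set in a single
  face of it. But this set accumulates at these three ends, one on each arc.
\<close>

lemma no_planar_K33_arcs:
  fixes e :: "'a \<Rightarrow> 'a \<Rightarrow> real \<Rightarrow> complex"
  assumes X: "distinct [x1, x2, x3]" and Y: "distinct [y1, y2, y3]"
    and XY: "{x1, x2, x3} \<inter> {y1, y2, y3} = {}"
    and p: "inj_on p ({x1, x2, x3} \<union> {y1, y2, y3})"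
    and arc: "\<And>x y. x \<in> {x1, x2, x3} \<Longrightarrow> y \<in> {y1, y2, y3} \<Longrightarrow>
            arc (e x y) \<and> pathstart (e x y) = p x \<and> pathfinish (e x y) = p y"
    and disj: "\<And>x y x' y'. x \<in> {x1, x2, x3} \<Longrightarrow> y \<in> {y1, y2, y3} \<Longrightarrow>
            x' \<in> {x1, x2, x3} \<Longrightarrow> y' \<in> {y1, y2, y3} \<Longrightarrow> (x, y) \<noteq> (x', y') \<Longrightarrow>
            path_image (e x y) \<inter> path_image (e x' y') \<subseteq> p ` ({x, y} \<inter> {x', y'})"
  shows False
proof -
  define f where "f y = e x1 y +++ reversepath (e x2 y)" for y
  have im: "path_image (f y) = path_image (e x1 y) \<union> path_image (e x2 y)"
    if "y \<in> {y1, y2, y3}" for y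
    using arc[of x1 y] arc[of x2 y] that unfolding f_def by (auto simp: path_image_join)
  have pxy: "p x \<in> path_image (e x y)" "p y \<in> path_image (e x y)"
    if "x \<in> {x1, x2, x3}" "y \<in> {y1, y2, y3}" for x y
    using arc[OF that] by (metis pathstart_in_path_image pathfinish_in_path_image)+
  have arcf: "arc (f y) \<and> pathstart (f y) = p x1 \<and> pathfinish (f y) = p x2"
    if y: "y \<in> {y1, y2, y3}" for y
  proof -
    have "path_image (e x1 y) \<inter> path_image (e x2 y) \<subseteq> {p y}"
      using disj[of x1 y x2 y] y X XY by auto
    then show ?thesis
      using arc[of x1 y] arc[of x2 y] y unfolding f_def
      by (auto intro!: arc_join arc_reversepath)
  qed
  have par: "parallel_arcs (p x1) (p x2) (f y) (f y')"
    if y: "y \<in> {y1, y2, y3}" "y' \<in> {y1, y2, y3}" "y \<noteq> y'" for y y'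
  proof -
    have "path_image (e x1 y) \<inter> path_image (e x1 y') \<subseteq> {p x1}"
      "path_image (e x1 y) \<inter> path_image (e x2 y') = {}"
      "path_image (e x2 y) \<inter> path_image (e x1 y') = {}"
      "path_image (e x2 y) \<inter> path_image (e x2 y') \<subseteq> {p x2}"
      using disj[of x1 y x1 y'] disj[of x1 y x2 y'] disj[of x2 y x1 y'] disj[of x2 y x2 y'] y X XY
      by auto
    then have "path_image (f y) \<inter> path_image (f y') \<subseteq> {p x1, p x2}"
      unfolding im[OF y(1)] im[OF y(2)] by blast
    moreover have "{p x1, p x2} \<subseteq> path_image (f y) \<inter> path_image (f y')"
      using pxy y unfolding im[OF y(1)] im[OF y(2)] by auto
    ultimately show ?thesis
      using arcf[OF y(1)] arcf[OF y(2)] unfolding parallel_arcs_def by auto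
  qed
  define W where "W = (\<Union>y\<in>{y1, y2, y3}. path_image (e x3 y) - {p y})"
  have leg: "topological_space_class.connected (path_image (e x3 y) - {p y})" "p y \<in> closure (path_image (e x3 y) - {p y})"
    "p x3 \<in> path_image (e x3 y) - {p y}" if "y \<in> {y1, y2, y3}" for y
    using arc[of x3 y] arc_minus_finish[of "e x3 y"] that by auto
  have "topological_space_class.connected W"
    unfolding W_def
  proof (rule connected_Union)
    show "topological_space_class.connected s" if "s \<in> (\<lambda>y. path_image (e x3 y) - {p y}) ` {y1, y2, y3}" for s
      using that leg(1) by auto
    show "\<Inter> ((\<lambda>y. path_image (e x3 y) - {p y}) ` {y1, y2, y3}) \<noteq> {}"
      using leg(3) by blast
  qed
  have off: "W \<inter> path_image (f y) = {}" if y: "y \<in> {y1, y2, y3}" for y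
  proof -
    have "(path_image (e x3 y') - {p y'}) \<inter> path_image (e x y) = {}"
      if "y' \<in> {y1, y2, y3}" "x \<in> {x1, x2}" for y' x
      using disj[of x3 y' x y] y that X XY by auto
    then show ?thesis
      unfolding W_def im[OF y] by blast
  qed
  have touch: "closure W \<inter> (path_image (f y) - {p x1, p x2}) \<noteq> {}" if y: "y \<in> {y1, y2, y3}" for y
  proof -
    have "p y \<notin> {p x1, p x2}"
      using p XY y unfolding inj_on_def by (metis IntI UnCI empty_iff insert_iff)
    moreover have "p y \<in> path_image (f y)"
      using pxy[of x1 y] y im by auto
    moreover have "p y \<in> closure W"
      using leg(2)[OF y] closure_mono[of "path_image (e x3 y) - {p y}" W] y unfolding W_def by auto
    ultimately show ?thesis by blast
  qed
  have "theta_curve (p x1) (p x2) (f y1) (f y2) (f y3)"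
    using par Y unfolding theta_curve_def by auto
  moreover have "W \<inter> (path_image (f y1) \<union> path_image (f y2) \<union> path_image (f y3)) = {}"
    using off by blast
  ultimately show False
    by (rule theta_no_common_face[OF _ \<open>topological_space_class.connected W\<close>]) (intro touch; simp)+
qed

text \<open>
  A drawing leaves open in which direction the curve of an edge runs; it remains to
  orient each curve from the \<open>x\<close> side to the \<open>y\<close> side.
\<close>

lemma K33_not_planar:
  assumes wf: "pair_wf_digraph G"
    and X: "distinct [x1, x2, x3]" and Y: "distinct [y1, y2, y3]"
    and XY: "{x1, x2, x3} \<inter> {y1, y2, y3} = {}"
    and sub: "{x1, x2, x3} \<times> {y1, y2, y3} \<subseteq> parcs G"
  shows "\<not> planar G"
proof
  assume "planar G"
  then obtain p c where d: "plane_drawing G p c" unfolding planar_def by blast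
  define e where "e x y = (if pathstart (c {x, y}) = p x then c {x, y} else reversepath (c {x, y}))"
    for x y
  have arc: "arc (e x y) \<and> pathstart (e x y) = p x \<and> pathfinish (e x y) = p y \<and>
      path_image (e x y) = path_image (c {x, y})" if "(x, y) \<in> parcs G" for x y
  proof -
    have "arc (c {x, y})" "{pathstart (c {x, y}), pathfinish (c {x, y})} = {p x, p y}"
      using d that unfolding plane_drawing_def by auto
    then show ?thesis
      unfolding e_def by (auto simp: doubleton_eq_iff arc_reversepath)
  qed
  show False
  proof (rule no_planar_K33_arcs[OF X Y XY, where p = p and e = e])
    have "{x1, x2, x3} \<union> {y1, y2, y3} \<subseteq> pverts G"
      using sub pair_wf_digraph.wellformed'[OF wf] by auto
    moreover have "inj_on p (pverts G)"
      using d unfolding plane_drawing_def by blast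
    ultimately show "inj_on p ({x1, x2, x3} \<union> {y1, y2, y3})"
      using inj_on_subset by blast
  next
    fix x y assume "x \<in> {x1, x2, x3}" "y \<in> {y1, y2, y3}"
    then show "arc (e x y) \<and> pathstart (e x y) = p x \<and> pathfinish (e x y) = p y"
      using arc sub by blast
  next
    fix x y x' y'
    assume a: "x \<in> {x1, x2, x3}" "y \<in> {y1, y2, y3}" "x' \<in> {x1, x2, x3}" "y' \<in> {y1, y2, y3}"
      "(x, y) \<noteq> (x', y')"
    then have "(x, y) \<in> parcs G" "(x', y') \<in> parcs G" "{x, y} \<noteq> {x', y'}"
      using sub XY by (auto simp: doubleton_eq_iff)
    then have "path_image (c {x, y}) \<inter> path_image (c {x', y'}) \<subseteq> p ` ({x, y} \<inter> {x', y'})"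
      using d unfolding plane_drawing_def by fast
    then show "path_image (e x y) \<inter> path_image (e x' y') \<subseteq> p ` ({x, y} \<inter> {x', y'})"
      using arc[OF \<open>(x, y) \<in> parcs G\<close>] arc[OF \<open>(x', y') \<in> parcs G\<close>] by simp
  qed
qed

section \<open>Distances in graphs of diameter two\<close>

context pair_wf_digraph
begin

lemma gdist_eq_INF_length: "gdist G u v = (INF p\<in>{p. awalk u p v}. ereal (length p))"
proof -
  have "awalk_cost (\<lambda>_. 1) p = length p" for p :: "('a \<times> 'a) list"
    by (induction p) auto
  then show ?thesis
    unfolding gdist_def \<mu>_def by simp
qed

lemma gdist_le_length: "awalk u p v \<Longrightarrow> gdist G u v \<le> ereal (length p)"
  unfolding gdist_eq_INF_length by (rule INF_lower) simp

lemma gdist_geI: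
  assumes "\<And>p. awalk u p v \<Longrightarrow> n \<le> length p"
  shows "ereal (real n) \<le> gdist G u v"
  unfolding gdist_eq_INF_length using assms by (intro INF_greatest) auto

lemma gdist_self:
  assumes "u \<in> pverts G"
  shows "gdist G u u = 0"
proof (rule antisym)
  show "gdist G u u \<le> 0"
    using gdist_le_length[of u "[]" u] assms by (simp add: awalk_Nil_iff zero_ereal_def)
  show "0 \<le> gdist G u u"
    using gdist_geI[of u u 0] by (simp add: zero_ereal_def)
qed

lemma gdist_adjacent:
  assumes "(u, v) \<in> parcs G" "u \<noteq> v"
  shows "gdist G u v = 1"
proof (rule antisym)
  show "gdist G u v \<le> 1"
    using gdist_le_length[of u "[(u, v)]" v] assms wellformed'
    by (simp add: awalk_Cons_iff awalk_Nil_iff one_ereal_def)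
  have "1 \<le> length p" if "awalk u p v" for p
    using that assms by (cases p) (auto simp: awalk_Nil_iff)
  then show "1 \<le> gdist G u v"
    using gdist_geI[of u v 1] by (simp add: one_ereal_def)
qed

lemma gdist_common_neighbour:
  assumes "(u, w) \<in> parcs G" "(w, v) \<in> parcs G" "(u, v) \<notin> parcs G" "u \<noteq> v"
  shows "gdist G u v = 2"
proof (rule antisym)
  show "gdist G u v \<le> 2"
    using gdist_le_length[of u "[(u, w), (w, v)]" v] assms wellformed'
    by (simp add: awalk_Cons_iff awalk_Nil_iff)
  have "2 \<le> length p" if "awalk u p v" for p
  proof (rule ccontr)
    assume "\<not> 2 \<le> length p"
    then consider "p = []" | e where "p = [e]"
      by (cases p; cases "tl p") auto
    then show False
      using that assms by cases (auto simp: awalk_Cons_iff awalk_Nil_iff)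
  qed
  then show "2 \<le> gdist G u v"
    using gdist_geI[of u v 2] by simp
qed

end

lemma connected_if_common_neighbours:
  assumes wf: "wf_digraph H" and ne: "verts H \<noteq> {}"
    and adj: "\<And>u v. u \<in> verts H \<Longrightarrow> v \<in> verts H \<Longrightarrow> u \<noteq> v \<Longrightarrow>
      (u, v) \<in> arcs_ends H \<or> (\<exists>w. (u, w) \<in> arcs_ends H \<and> (w, v) \<in> arcs_ends H)"
  shows "Digraph_Component.connected H"
proof -
  interpret wf_digraph H by (rule wf)
  show ?thesis
  proof (rule connectedI[OF ne])
    fix u v assume uv: "u \<in> verts H" "v \<in> verts H"
    have "u \<rightarrow>\<^sup>*\<^bsub>H\<^esub> v"
      using adj[OF uv] uv reachable_adj_trans adj_reachable_trans reachable_adjI reachable_refl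
      by (cases "u = v") blast+
    then show "u \<rightarrow>\<^sup>*\<^bsub>mk_symmetric H\<^esub> v" by (rule reachable_mk_symmetricI)
  qed
qed

section \<open>The complement of two stars\<close>

text \<open>
  The edges of two disjoint stars: one with centre \<open>0\<close> and all leaves from \<open>4\<close> on, the other with
  centre \<open>1\<close> and leaves \<open>2\<close> and \<open>3\<close>.
\<close>

definition nonadjacent :: "nat \<Rightarrow> nat \<Rightarrow> bool" where
  "nonadjacent u v \<longleftrightarrow> u = 0 \<and> 4 \<le> v \<or> v = 0 \<and> 4 \<le> u \<or> u = 1 \<and> v \<in> {2, 3} \<or> v = 1 \<and> u \<in> {2, 3}"

definition two_star_complement :: "nat \<Rightarrow> nat pair_pre_digraph" where
  "two_star_complement k =
     \<lparr>pverts = {..<k + 3},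
      parcs = {(u, v). u < k + 3 \<and> v < k + 3 \<and> u \<noteq> v \<and> \<not> nonadjacent u v}\<rparr>"

lemma two_star_complement_simps:
  "pverts (two_star_complement k) = {..<k + 3}"
  "(u, v) \<in> parcs (two_star_complement k) \<longleftrightarrow> u < k + 3 \<and> v < k + 3 \<and> u \<noteq> v \<and> \<not> nonadjacent u v"
  unfolding two_star_complement_def by auto

lemma pair_graph_two_star_complement: "pair_graph (two_star_complement k)"
proof -
  have "parcs (two_star_complement k) \<subseteq> {..<k + 3} \<times> {..<k + 3}"
    unfolding two_star_complement_def by auto
  then have "finite (parcs (two_star_complement k))"
    by (rule finite_subset) auto
  then show ?thesis
    by unfold_locales
      (auto simp: two_star_complement_def nonadjacent_def symmetric_def intro!: symI)
qed

text \<open>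
  In the complement the two centres \<open>0\<close> and \<open>1\<close> are adjacent, and each is adjacent to
  all leaves of the other star.
\<close>

lemma nonadjacent_common_neighbour:
  assumes "k \<ge> 3" "nonadjacent u v" "u < k + 3" "v < k + 3"
  obtains w where "(u, w) \<in> parcs (two_star_complement k)" "(w, v) \<in> parcs (two_star_complement k)"
  using assms that[of 0] that[of 1] unfolding two_star_complement_simps nonadjacent_def by auto

lemma gdist_two_star_complement:
  assumes "k \<ge> 3" "u < k + 3" "v < k + 3"
  shows "gdist (two_star_complement k) u v = (if u = v then 0 else if nonadjacent u v then 2 else 1)"
proof -
  interpret pair_graph "two_star_complement k" by (rule pair_graph_two_star_complement)
  show ?thesis
  proof (cases "u \<noteq> v \<and> nonadjacent u v")
    case True
    then show ?thesis
      using nonadjacent_common_neighbour[OF assms(1) _ assms(2,3)] gdist_common_neighbour[of u _ v]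
        two_star_complement_simps(2)[of u v k] by metis
  next
    case False
    then show ?thesis
      using assms gdist_self[of u] gdist_adjacent[of u v] by (auto simp: two_star_complement_simps)
  qed
qed

lemma connected_two_star_complement:
  assumes "k \<ge> 3"
  shows "Digraph_Component.connected (with_proj (two_star_complement k))"
proof (rule connected_if_common_neighbours)
  interpret pair_graph "two_star_complement k" by (rule pair_graph_two_star_complement)
  show "wf_digraph (with_proj (two_star_complement k))" ..
  have "0 \<in> verts (with_proj (two_star_complement k))"
    by (simp add: two_star_complement_simps)
  then show "verts (with_proj (two_star_complement k)) \<noteq> {}"
    by blast
  fix u v
  assume "u \<in> verts (with_proj (two_star_complement k))" "v \<in> verts (with_proj (two_star_complement k))"
    "u \<noteq> v"
  then show "(u, v) \<in> arcs_ends (with_proj (two_star_complement k)) \<or>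
      (\<exists>w. (u, w) \<in> arcs_ends (with_proj (two_star_complement k)) \<and>
           (w, v) \<in> arcs_ends (with_proj (two_star_complement k)))"
    using nonadjacent_common_neighbour[OF assms, of u v] two_star_complement_simps(2)[of u v k]
    by (simp add: two_star_complement_simps(1)) metis
qed

text \<open>
  The set consists of all leaves of the large star but one, its centre \<open>0\<close>, and the leaf \<open>2\<close> of the
  small star. For the three vertices left out, \<open>0\<close> singles out the missing large leaf \<open>k + 2\<close>,
  and \<open>2\<close> separates \<open>1\<close> from \<open>3\<close>. Connectedness holds because \<open>2\<close> is adjacent to the rest of the set.
\<close>

lemma connected_resolving_set_two_star_complement:
  assumes "k \<ge> 3"
  defines "S \<equiv> {0, 2} \<union> {4..<k + 2}"
  shows "connected_resolving_set (two_star_complement k) S" and "card S = k"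
proof -
  let ?G = "two_star_complement k"
  interpret pair_graph ?G by (rule pair_graph_two_star_complement)
  have sub: "S \<subseteq> {..<k + 3}" using assms by auto
  have "\<exists>z\<in>S. gdist ?G x z \<noteq> gdist ?G y z" if xy: "x < k + 3" "y < k + 3" "x \<noteq> y" for x y
  proof (cases "x \<in> S \<or> y \<in> S")
    case True
    then show ?thesis
    proof
      assume "x \<in> S"
      then show ?thesis
        using xy assms(1) by (intro bexI[of _ x]) (auto simp: gdist_two_star_complement)
    next
      assume "y \<in> S"
      then show ?thesis
        using xy assms(1) by (intro bexI[of _ y]) (auto simp: gdist_two_star_complement)
    qed
  next
    case False
    have in3: "v \<in> {1, 3, k + 2}" if "v < k + 3" "v \<notin> S" for v
      using that unfolding S_def by auto
    have "x \<in> {1, 3, k + 2}" "y \<in> {1, 3, k + 2}" using in3 xy False by auto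
    moreover have "gdist ?G 1 0 = 1" "gdist ?G 3 0 = 1" "gdist ?G (k + 2) 0 = 2"
      "gdist ?G 1 2 = 2" "gdist ?G 3 2 = 1"
      using assms(1) by (simp_all add: gdist_two_star_complement nonadjacent_def)
    moreover have "0 \<in> S" "2 \<in> S" unfolding S_def by auto
    moreover have "(1::ereal) \<noteq> 2" by simp
    ultimately show ?thesis using xy(3) by (elim insertE emptyE) metis+
  qed
  then have "resolving_set ?G S"
    unfolding resolving_set_def using sub by (simp add: two_star_complement_simps)
  moreover have "Digraph_Component.connected (with_proj ?G \<restriction> S)"
  proof (rule connected_if_common_neighbours)
    show "wf_digraph (with_proj ?G \<restriction> S)"
      using wellformed by unfold_locales auto
    have ends: "(u, v) \<in> arcs_ends (with_proj ?G \<restriction> S) \<longleftrightarrow> u \<in> S \<and> v \<in> S \<and> (u, v) \<in> parcs ?G" for u v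
      by (auto simp: arcs_ends_conv induce_subgraph_def image_iff)
    have "(u, 2) \<in> parcs ?G \<and> (2, u) \<in> parcs ?G" if "u \<in> S" "u \<noteq> 2" for u
      using that sub assms(1) unfolding S_def two_star_complement_simps nonadjacent_def by auto
    moreover have "2 \<in> S" unfolding S_def by simp
    ultimately show "(u, v) \<in> arcs_ends (with_proj ?G \<restriction> S) \<or>
        (\<exists>w. (u, w) \<in> arcs_ends (with_proj ?G \<restriction> S) \<and> (w, v) \<in> arcs_ends (with_proj ?G \<restriction> S))"
      if "u \<in> verts (with_proj ?G \<restriction> S)" "v \<in> verts (with_proj ?G \<restriction> S)" "u \<noteq> v" for u v
      using that unfolding ends by (cases "u = 2"; cases "v = 2") auto
  qed (auto simp: S_def)
  ultimately show "connected_resolving_set ?G S"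
    unfolding connected_resolving_set_def ..
  have "card S = card {0, 2 :: nat} + card {4..<k + 2}"
    unfolding S_def by (rule card_Un_disjoint) auto
  then show "card S = k" using assms(1) by simp
qed

text \<open>
  Two leaves of the same star are twins: only they themselves tell them apart. So \<open>S\<close> omits at most
  one leaf of each star. With fewer than \<open>k\<close> elements it omits exactly one leaf, \<open>x\<close> and \<open>c\<close>, of
  either star and contains neither centre. But the distances of \<open>x\<close> and \<open>c\<close> to all other
  leaves are \<open>1\<close>, and only the centres could separate them.
\<close>

lemma card_resolving_set_two_star_complement:
  assumes k: "k \<ge> 3" and S: "resolving_set (two_star_complement k) S"
  shows "k \<le> card S"
proof (rule ccontr)
  let ?A = "{4..<k + 3}"
  assume "\<not> k \<le> card S"
  then have small: "card S \<le> k - 1" by simp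
  have sub: "S \<subseteq> {..<k + 3}"
    using S unfolding resolving_set_def by (simp add: two_star_complement_simps)
  then have fin: "finite S" by (rule finite_subset) simp
  have res: "\<exists>z\<in>S. z = x \<or> z = y \<or> nonadjacent x z \<noteq> nonadjacent y z"
    if xy: "x < k + 3" "y < k + 3" "x \<noteq> y" for x y
  proof -
    obtain z where z: "z \<in> S" "gdist (two_star_complement k) x z \<noteq> gdist (two_star_complement k) y z"
      using S xy unfolding resolving_set_def two_star_complement_simps by blast
    then have "z < k + 3" using sub by auto
    then show ?thesis
      using z k xy gdist_two_star_complement[of k _ z] by (metis (full_types))
  qed
  have twins23: "2 \<in> S \<or> 3 \<in> S"
    using res[of 2 3] k unfolding nonadjacent_def by auto
  have twinsA: "x \<in> S \<or> y \<in> S" if "x \<in> ?A" "y \<in> ?A" "x \<noteq> y" for x y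
    using res[of x y] that unfolding nonadjacent_def by auto
  have cardA: "card ?A = k - 1" by simp
  obtain x where x: "x \<in> ?A" "x \<notin> S"
  proof (rule ccontr)
    assume "\<not> thesis"
    then have "?A \<subseteq> S" using that by blast
    then have "insert (if 2 \<in> S then 2 else 3) ?A \<subseteq> S" using twins23 by auto
    then have "card (insert (if 2 \<in> S then 2 else 3) ?A) \<le> card S" by (rule card_mono[OF fin])
    then show False using small cardA k by auto
  qed
  obtain b c where bc: "{b, c} = {2, 3::nat}" "b \<noteq> c" "b \<in> S"
    using twins23 by (metis insert_commute numeral_eq_iff semiring_norm(89))
  let ?T = "insert b (?A - {x})"
  have "?T \<subseteq> S" using twinsA x bc by blast
  moreover have "card ?T = k - 1"
  proof -
    have "b \<notin> ?A - {x}" using bc by (auto simp: doubleton_eq_iff)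
    then have "card ?T = Suc (card (?A - {x}))" by (intro card_insert_disjoint) auto
    also have "card (?A - {x}) = k - 2" using x cardA by (simp add: card_Diff_singleton)
    finally show ?thesis using k by simp
  qed
  ultimately have ST: "S = ?T"
    using small fin by (metis card_seteq)
  have "c < k + 3" "x \<noteq> c" "x < k + 3" using bc x by (auto simp: doubleton_eq_iff)
  then obtain z where "z \<in> S" "z = x \<or> z = c \<or> nonadjacent x z \<noteq> nonadjacent c z"
    using res[of x c] by blast
  then show False
    using ST bc x unfolding nonadjacent_def by (auto simp: doubleton_eq_iff)
qed

lemma cdim_two_star_complement:
  assumes "k \<ge> 3"
  shows "cdim (two_star_complement k) = k"
  unfolding cdim_def
proof (rule Least_equality)
  show "\<exists>S. connected_resolving_set (two_star_complement k) S \<and> card S = k"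
    using connected_resolving_set_two_star_complement[OF assms] by blast
  show "k \<le> n" if "\<exists>S. connected_resolving_set (two_star_complement k) S \<and> card S = n" for n
    using that card_resolving_set_two_star_complement[OF assms] unfolding connected_resolving_set_def by blast
qed

lemma two_star_complement_not_planar:
  assumes "k \<ge> 3"
  shows "\<not> planar (two_star_complement k)"
proof (rule K33_not_planar[where ?x1.0 = 0 and ?x2.0 = 4 and ?x3.0 = 5 and
      ?y1.0 = 1 and ?y2.0 = 2 and ?y3.0 = 3])
  interpret pair_graph "two_star_complement k" by (rule pair_graph_two_star_complement)
  show "pair_wf_digraph (two_star_complement k)" ..
  show "{0, 4, 5} \<times> {1, 2, 3} \<subseteq> parcs (two_star_complement k)"
    using assms by (auto simp: two_star_complement_simps nonadjacent_def)
qed auto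

theorem mainTheorem7:
  fixes k :: nat
  assumes "k \<ge> 3"
  shows "\<exists>G :: nat pair_pre_digraph.
           pair_graph G \<and> Digraph_Component.connected (with_proj G) \<and> \<not> planar G \<and> cdim G = k"
  using pair_graph_two_star_complement connected_two_star_complement[OF assms]
    two_star_complement_not_planar[OF assms] cdim_two_star_complement[OF assms] by blast

end
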